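(* Let $d\geq 2$ be an integer, let $p$ be a prime, and let $\epsilon>0$. Then there exists a $d$-generated, infinite, residually finite $p$-group $\Gamma$ with $\mathrm{rg}(\Gamma)\geq d-1-\epsilon$.
   Context: A (possibly infinite) group is a $p$-group if every element has finite order equal to a power of $p$. A group is $d$-generated if it can be generated by $d$ elements. For a finitely generated group $G$, $d(G)$ denotes the minimal number of generators of $G$. Rank gradient: let $\Gamma$ be a finitely generated, residually finite, infinite group. For a sequence $\mathcal{N}=(N_i)_{i=1}^\infty$ of finite index normal subgroups of $\Gamma$ with $\bigcap_i N_i=\{1\}$, define $\mathrm{rg}(\Gamma,\mathcal{N})=\liminf_{i\to\infty}\frac{d(N_i)}{(\Gamma:N_i)}$. The rank gradient $\mathrm{rg}(\Gamma)$ is the infimum of $\mathrm{rg}(\Gamma,\mathcal{N})$ over all such sequences $\mathcal{N}$. *)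

theory Defs
  imports
    "HOL-Algebra.Algebra"
    "HOL-Computational_Algebra.Primes"
    "HOL-Library.Extended_Real"
    "HOL-Library.Liminf_Limsup"
begin

text \<open>Generation by \<open>d\<close> elements allows repetitions, hence \<open>card S \<le> d\<close>.\<close>

definition generated_by_card :: "('a, 'b) monoid_scheme \<Rightarrow> nat \<Rightarrow> bool" where
  "generated_by_card G d \<longleftrightarrow>
     (\<exists>S. S \<subseteq> carrier G \<and> finite S \<and> card S \<le> d \<and> generate G S = carrier G)"

text \<open>Meaningful only for finitely generated \<open>G\<close>; otherwise the value is unspecified.\<close>

definition min_generators :: "('a, 'b) monoid_scheme \<Rightarrow> nat" where
  "min_generators G = (LEAST n. generated_by_card G n)"

text \<open>The library's \<open>group.ord\<close> is \<open>0\<close> on elements of infinite order, so the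
  equation \<open>ord x = p ^ k\<close> with \<open>p\<close> prime includes finiteness of the order.\<close>

definition p_group :: "nat \<Rightarrow> ('a, 'b) monoid_scheme \<Rightarrow> bool" where
  "p_group p G \<longleftrightarrow> group G \<and> (\<forall>x\<in>carrier G. \<exists>k. group.ord G x = p ^ k)"

definition finite_index_normal :: "'a set \<Rightarrow> ('a, 'b) monoid_scheme \<Rightarrow> bool" where
  "finite_index_normal N G \<longleftrightarrow> N \<lhd> G \<and> finite (rcosets\<^bsub>G\<^esub> N)"

definition residually_finite :: "('a, 'b) monoid_scheme \<Rightarrow> bool" where
  "residually_finite G \<longleftrightarrow> group G \<and>
     (\<forall>x\<in>carrier G. x \<noteq> \<one>\<^bsub>G\<^esub> \<longrightarrow> (\<exists>N. finite_index_normal N G \<and> x \<notin> N))"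

definition rank_gradient_along ::
    "('a, 'b) monoid_scheme \<Rightarrow> (nat \<Rightarrow> 'a set) \<Rightarrow> ereal" where
  "rank_gradient_along G N =
     liminf (\<lambda>i. ereal (real (min_generators (G\<lparr>carrier := N i\<rparr>)) /
                        real (card (rcosets\<^bsub>G\<^esub> (N i)))))"

text \<open>The sequences are not required to be nested. For \<open>G\<close> finitely generated and
  residually finite (hence countable) at least one such sequence exists, so the
  infimum is then over a nonempty set.\<close>

definition rank_gradient :: "('a, 'b) monoid_scheme \<Rightarrow> ereal" where
  "rank_gradient G =
     Inf {rank_gradient_along G N | N.
            (\<forall>i. finite_index_normal (N i) G) \<and> (\<Inter>i. N i) = {\<one>\<^bsub>G\<^esub>}}"

end

theory Submission
  imports Defs
begin

text \<open>
Impose on the free monoid on \<open>d\<close> letters one relator \<open>w ^ (p ^ n w) = 1\<close> for every word \<open>w\<close>, with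
exponents so large that the sum of all \<open>1 / p ^ n w\<close> is at most \<open>\<epsilon>\<close>, and let the group \<open>\<Gamma>\<close> consist of the
words modulo the intersection of all finite-index congruences that contain these relators. It is a
group because every word has a positive power equal to \<open>1\<close>; it is a \<open>p\<close>-group by the relators, and
residually finite by construction (\<open>residually_finite\<close>).

For the rank gradient, let \<open>N\<close> be normal in \<open>\<Gamma>\<close> with finite quotient \<open>Q\<close> of order \<open>n\<close>. Labellings of the
\<open>d * n\<close> edges of the Cayley graph of \<open>Q\<close> by residues modulo \<open>p\<close> give, by summing labels along closed
paths, homomorphisms from the loops at \<open>1\<close> to the integers modulo \<open>p\<close>. Such a map descends to \<open>N\<close> as soon as
all relators have path sum zero from every vertex (\<open>path_sum_mod_well_defined\<close>): it then comes
from a finite quotient of the word monoid obeying the relators, and \<open>\<Gamma>\<close> maps onto all of those. A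
relator \<open>w ^ (p ^ n w)\<close> whose exponent exceeds the order of \<open>w\<close> in \<open>Q\<close> runs a multiple of \<open>p\<close> times around
a closed path and imposes nothing. If the two are equal, its conditions are
constant along the cosets of the subgroup generated by \<open>w\<close>, so there are only \<open>n / p ^ n w\<close> of them
(\<open>path_sum_power_of_order\<close>, \<open>path_sum_relator\<close>).

A labelling that meets these conditions and vanishes on a generating set of \<open>N\<close> is a coboundary,
given by one residue for each element of \<open>Q\<close> (\<open>edge_function_vanishes\<close>). Counting labellings therefore yields
\<open>d * n \<le> card S + n + \<epsilon> * n\<close> for every generating set \<open>S\<close> of \<open>N\<close> (\<open>generator_count\<close>,
\<open>sum_orbits_le\<close>), which is the claimed bound. The same inequality shows that \<open>\<Gamma>\<close> is infinite when
\<open>\<epsilon> < d - 1\<close>, since in a finite group it could be applied to the trivial subgroup with \<open>S\<close> empty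
(\<open>infinite_carrier\<close>).
\<close>

section \<open>Words and marked groups\<close>

definition word_pow :: "'a list \<Rightarrow> nat \<Rightarrow> 'a list" where
  "word_pow w n = concat (replicate n w)"

lemma word_pow_0 [simp]: "word_pow w 0 = []"
  by (simp add: word_pow_def)

lemma word_pow_Suc: "word_pow w (Suc n) = w @ word_pow w n"
  by (simp add: word_pow_def)

lemma word_pow_add: "word_pow w (m + n) = word_pow w m @ word_pow w n"
  by (simp add: word_pow_def replicate_add)

text \<open>A quotient of the free monoid on \<open>d\<close> letters that happens to be a group. Words range over the
whole type \<open>nat list\<close> instead of the lists over \<open>{..<d}\<close>; sending the remaining letters to \<open>\<one>\<close>
removes every side condition on words. Inverse letters are absent, since in a torsion group the
inverse of a letter is one of its positive powers.\<close>

locale marked_group = group G for G (structure) +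
  fixes ev :: "nat list \<Rightarrow> 'a" and d :: nat
  assumes ev_Nil [simp]: "ev [] = \<one>"
    and ev_append [simp]: "ev (u @ v) = ev u \<otimes> ev v"
    and range_ev: "range ev = carrier G"
    and ev_trivial: "d \<le> a \<Longrightarrow> ev [a] = \<one>"
begin

lemma ev_closed [simp]: "ev w \<in> carrier G"
  using range_ev by blast

lemma ev_Cons: "ev (a # w) = ev [a] \<otimes> ev w"
  using ev_append[of "[a]" w] by simp

lemma ev_word_pow: "ev (word_pow w n) = ev w [^] n"
proof (induction n)
  case (Suc n)
  then show ?case
    using nat_pow_Suc2[of "ev w" n] by (simp add: word_pow_Suc)
qed simp

definition word_of :: "'a \<Rightarrow> nat list" where
  "word_of g = inv_into UNIV ev g"

lemma ev_word_of: "g \<in> carrier G \<Longrightarrow> ev (word_of g) = g"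
  using range_ev by (simp add: word_of_def f_inv_into_f)

lemma generate_letters: "generate G ((\<lambda>a. ev [a]) ` {..<d}) = carrier G"
proof
  let ?S = "(\<lambda>a. ev [a]) ` {..<d}"
  show "generate G ?S \<subseteq> carrier G"
    by (intro generate_incl) auto
  have "ev w \<in> generate G ?S" for w
  proof (induction w)
    case Nil
    then show ?case by (simp add: generate.one)
  next
    case (Cons a w)
    have "ev [a] \<in> generate G ?S"
      by (cases "a < d") (auto simp: ev_trivial generate.one intro: generate.incl)
    with Cons show ?case
      by (subst ev_Cons) (rule generate.eng)
  qed
  then show "carrier G \<subseteq> generate G ?S"
    unfolding range_ev[symmetric] by blast
qed

lemma generated_by_d: "generated_by_card G d"
  unfolding generated_by_card_def
proof (intro exI conjI)
  show "card ((\<lambda>a. ev [a]) ` {..<d}) \<le> d"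
    using card_image_le[of "{..<d}" "\<lambda>a. ev [a]"] by simp
  show "generate G ((\<lambda>a. ev [a]) ` {..<d}) = carrier G"
    by (rule generate_letters)
qed auto

section \<open>Path sums in the Cayley graph\<close>

text \<open>A function \<open>c\<close> labels the edges \<open>q \<rightarrow> ev [a] \<otimes> q\<close> of the left Cayley graph by integers. A word is
read from its last letter to its first, matching \<open>ev (a # w) = ev [a] \<otimes> ev w\<close>, and so traces a path
from \<open>q\<close> to \<open>ev w \<otimes> q\<close>; its labels are added up. Restricted to the words with \<open>ev w = \<one>\<close>, a path
sum from a fixed vertex is additive: this produces homomorphisms without any basis of the
kernel.\<close>

fun path_sum :: "('a \<Rightarrow> nat \<Rightarrow> int) \<Rightarrow> 'a \<Rightarrow> nat list \<Rightarrow> int" where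
  "path_sum c q [] = 0"
| "path_sum c q (a # w) = path_sum c q w + c (ev w \<otimes> q) a"

lemma path_sum_append:
  assumes "q \<in> carrier G"
  shows "path_sum c q (u @ v) = path_sum c q v + path_sum c (ev v \<otimes> q) u"
  using assms by (induction u) (simp_all add: m_assoc)

lemma path_sum_diff:
  "path_sum (\<lambda>q a. c q a - c' q a) q w = path_sum c q w - path_sum c' q w"
  by (induction w) simp_all

lemma path_sum_word_pow:
  assumes "q \<in> carrier G"
  shows "path_sum c q (word_pow w n) = (\<Sum>j<n. path_sum c (ev w [^] j \<otimes> q) w)"
  using assms by (induction n) (simp_all add: word_pow_Suc path_sum_append ev_word_pow)

lemma bij_betw_powers_coset:
  assumes "x \<in> carrier G" "q \<in> carrier G" "ord x \<noteq> 0"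
  shows "bij_betw (\<lambda>j. x [^] j \<otimes> q) {..<ord x} (generate G {x} #> q)"
proof -
  have eq: "{..<ord x} = {0..ord x - 1}"
    using assms by auto
  have gen: "generate G {x} = (\<lambda>j. x [^] j) ` {..<ord x}"
    using generate_pow_nat[OF assms(1,3)] ord_elems_inf_carrier[OF assms(1,3)]
    unfolding eq by auto
  have "inj_on (\<lambda>j. x [^] j \<otimes> q) {..<ord x}"
    using ord_inj[OF assms(1)] assms by (auto simp: eq inj_on_def)
  then show ?thesis
    by (auto simp: bij_betw_def gen r_coset_def)
qed

text \<open>The path that reads \<open>w\<close> over and over from \<open>q\<close> closes up after \<open>m\<close> rounds, having visited each
element of the right coset of \<open>q\<close> modulo \<open>\<langle>ev w\<rangle>\<close> once at the start of a round. Hence the sum depends on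
that coset only, and the \<open>m\<close> vertices of a coset yield a single linear condition. This is the
source of the factor \<open>1 / m\<close> in the rank bound.\<close>

lemma path_sum_power_of_order:
  assumes q: "q \<in> carrier G" and m: "ord (ev w) = m" "m \<noteq> 0"
  shows "path_sum c q (word_pow w (t * m)) =
         int t * (\<Sum>r\<in>generate G {ev w} #> q. path_sum c r w)"
proof (induction t)
  case (Suc t)
  have "ev (word_pow w (t * m)) = \<one>"
    using m by (simp add: ev_word_pow pow_eq_id)
  moreover have "path_sum c q (word_pow w m) = (\<Sum>r\<in>generate G {ev w} #> q. path_sum c r w)"
    using sum.reindex_bij_betw[OF bij_betw_powers_coset[of "ev w" q]] q m
    by (simp add: path_sum_word_pow)
  ultimately show ?case
    using Suc q by (simp add: word_pow_add path_sum_append algebra_simps)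
qed simp

section \<open>Normal subgroups of finite index\<close>

lemma marked_quotient:
  assumes "N \<lhd> G"
  shows "marked_group (G Mod N) (\<lambda>w. N #> ev w) d"
proof -
  interpret N: normal N G by fact
  interpret Q: group "G Mod N" by (rule N.factorgroup_is_group)
  show ?thesis
  proof
    show "range (\<lambda>w. N #> ev w) = carrier (G Mod N)"
      by (simp add: carrier_FactGroup image_image flip: range_ev)
  qed (simp_all add: N.rcos_sum ev_trivial N.subset)
qed

text \<open>Schreier's argument: with a transversal \<open>t\<close> that represents \<open>N\<close> itself by \<open>\<one>\<close>, the elements
\<open>s q a\<close> generate \<open>N\<close>. Without this, the minimal number of generators of \<open>N\<close>, a \<open>LEAST\<close>, could be
an arbitrary number.\<close>

lemma finite_index_normal_finitely_generated:
  assumes "finite_index_normal N G"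
  shows "\<exists>n. generated_by_card (G\<lparr>carrier := N\<rparr>) n"
proof -
  have N: "N \<lhd> G" and fin: "finite (rcosets N)"
    using assms by (auto simp: finite_index_normal_def)
  interpret N: normal N G by fact
  define t where "t q = (if q = N then \<one> else SOME g. g \<in> carrier G \<and> N #> g = q)" for q
  have t: "t q \<in> carrier G" "N #> t q = q" if "q \<in> rcosets N" for q
  proof -
    have "\<exists>g. g \<in> carrier G \<and> N #> g = q"
      using that by (auto simp: RCOSETS_def)
    from someI_ex[OF this] show "t q \<in> carrier G" "N #> t q = q"
      by (auto simp: t_def N.subset)
  qed
  define s where "s q a = inv (t (N #> (ev [a] \<otimes> t q))) \<otimes> (ev [a] \<otimes> t q)" for q a
  define S where "S = (\<lambda>(q, a). s q a) ` ((rcosets N) \<times> {..<d})"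
  have coset: "N #> g \<in> rcosets N" if "g \<in> carrier G" for g
    using that N.subset by (simp add: rcosetsI)
  have in_N: "inv (t (N #> g)) \<otimes> g \<in> N" if g: "g \<in> carrier G" for g
  proof -
    have "g \<in> N #> t (N #> g)"
      using t(2)[OF coset[OF g]] rcos_self[OF g N.is_subgroup] by simp
    then obtain h where "h \<in> N" "g = h \<otimes> t (N #> g)"
      by (auto simp: r_coset_def)
    with t(1)[OF coset[OF g]] N.inv_op_closed1 g show ?thesis
      by (metis N.mem_carrier inv_closed m_assoc)
  qed
  have "S \<subseteq> N"
    using in_N t by (auto simp: S_def s_def)
  have step: "inv (t (N #> ev w)) \<otimes> ev w \<in> generate G S" for w
  proof (induction w)
    case Nil
    then show ?case by (simp add: t_def N.subset generate.one)
  next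
    case (Cons a w)
    define q where "q = N #> ev w"
    have q: "q \<in> rcosets N" by (simp add: q_def coset)
    have next_coset: "N #> (ev [a] \<otimes> t q) = N #> ev (a # w)"
    proof -
      have "N #> (ev [a] \<otimes> t q) = (N #> ev [a]) <#> (N #> ev w)"
        using N.rcos_sum[of "ev [a]" "t q"] t[OF q] by (simp add: q_def)
      also have "\<dots> = N #> ev (a # w)"
        by (subst (2) ev_Cons) (simp add: N.rcos_sum)
      finally show ?thesis .
    qed
    have "s q a \<in> generate G S"
    proof (cases "a < d")
      case True
      then show ?thesis using q by (auto simp: S_def intro!: generate.incl)
    next
      case False
      then show ?thesis using t[OF q] by (simp add: s_def ev_trivial generate.one)
    qed
    then have "s q a \<otimes> (inv (t q) \<otimes> ev w) \<in> generate G S"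
      using Cons by (auto simp: q_def intro: generate.eng)
    moreover have "s q a \<otimes> (inv (t q) \<otimes> ev w) = inv (t (N #> ev (a # w))) \<otimes> ev (a # w)"
    proof -
      have "t q \<otimes> (inv (t q) \<otimes> ev w) = ev w"
        using t(1)[OF q] by (simp flip: m_assoc)
      then have "(ev [a] \<otimes> t q) \<otimes> (inv (t q) \<otimes> ev w) = ev (a # w)"
        using t(1)[OF q] by (simp add: m_assoc flip: ev_Cons)
      then show ?thesis
        unfolding s_def next_coset using t(1)[OF q] t(1)[OF coset[of "ev (a # w)"]]
        by (simp add: m_assoc)
    qed
    ultimately show ?case by simp
  qed
  have "N \<subseteq> generate G S"
  proof
    fix g assume g: "g \<in> N"
    then obtain w where w: "g = ev w"
      using range_ev N.subset by blast
    have "N #> g = N"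
      using g by (simp add: N.rcos_const)
    with step[of w] show "g \<in> generate G S"
      using N.mem_carrier[OF g] by (simp add: w t_def)
  qed
  then have "generate G S = N"
    using generate_subgroup_incl[OF \<open>S \<subseteq> N\<close> N.is_subgroup] by blast
  then have "generated_by_card (G\<lparr>carrier := N\<rparr>) (card S)"
    unfolding generated_by_card_def using \<open>S \<subseteq> N\<close> fin
    by (intro exI[of _ S]) (simp add: generate_consistent N.is_subgroup S_def)
  then show ?thesis ..
qed

end
section \<open>The universal residually finite torsion quotient\<close>

text \<open>The kernels of the homomorphisms from the word monoid to finite groups that kill the surplus
letters and satisfy the relators \<open>w ^ (p ^ (to_nat w + k)) = 1\<close>. The encoding of words gives every word an exponent of its own, so that
the reciprocals of all exponents sum to at most \<open>2 / 2 ^ k\<close>, and it makes all words torsion.\<close>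

definition torsion_congruence :: "nat \<Rightarrow> nat \<Rightarrow> nat \<Rightarrow> (nat list \<times> nat list) set \<Rightarrow> bool" where
  "torsion_congruence d p k E \<longleftrightarrow>
     equiv UNIV E \<and> finite (UNIV // E) \<and>
     (\<forall>u u' v v'. (u, u') \<in> E \<longrightarrow> (v, v') \<in> E \<longrightarrow> (u @ v, u' @ v') \<in> E) \<and>
     (\<forall>a\<ge>d. ([a], []) \<in> E) \<and>
     (\<forall>w. (word_pow w (p ^ (to_nat w + k)), []) \<in> E)"

text \<open>Two words agree in the group exactly when no finite quotient obeying the relators separates them.
This builds residual finiteness into the group. In the other direction it is a recognition
principle: anything constant on the classes of a torsion congruence is well defined on the group.\<close>

locale torsion_group = marked_group G ev d for G (structure) and ev d +
  fixes p k :: nat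
  assumes prime_p: "Factorial_Ring.prime p"
    and ev_eq_iff: "ev u = ev v \<longleftrightarrow> (\<forall>E. torsion_congruence d p k E \<longrightarrow> (u, v) \<in> E)"
begin

lemma p_pos: "0 < p"
  using prime_p by (rule prime_gt_0_nat)

lemma ev_relator: "ev w [^] (p ^ (to_nat w + k)) = \<one>"
proof -
  have "ev (word_pow w (p ^ (to_nat w + k))) = ev []"
    unfolding ev_eq_iff by (simp add: torsion_congruence_def)
  then show ?thesis by (simp add: ev_word_pow)
qed

lemma p_group: "p_group p G"
  unfolding p_group_def
proof (intro conjI ballI)
  show "group G" by unfold_locales
  fix x assume "x \<in> carrier G"
  then obtain w where w: "x = ev w" using range_ev by blast
  then have "ord x dvd p ^ (to_nat w + k)"
    using ev_relator[of w] pow_eq_id[of x] by simp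
  then show "\<exists>i. ord x = p ^ i"
    using prime_p divides_primepow_nat by blast
qed

text \<open>If \<open>x \<noteq> \<one>\<close>, some torsion congruence \<open>E\<close> separates a word of \<open>x\<close> from the empty word. The elements
represented by words \<open>E\<close>-equivalent to \<open>[]\<close> form the required normal subgroup: the cosets of
equivalent words coincide, so the index is at most the number of classes of \<open>E\<close>.\<close>

lemma residually_finite: "residually_finite G"
  unfolding residually_finite_def
proof (intro conjI ballI impI)
  show "group G" by unfold_locales
  fix x assume x: "x \<in> carrier G" "x \<noteq> \<one>"
  then obtain w where w: "x = ev w" using range_ev by blast
  with x have "ev w \<noteq> ev []" by simp
  then obtain E where E: "torsion_congruence d p k E" and wE: "(w, []) \<notin> E"
    unfolding ev_eq_iff by blast
  from E have equiv: "equiv UNIV E"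
    and app: "\<And>u u' v v'. (u, u') \<in> E \<Longrightarrow> (v, v') \<in> E \<Longrightarrow> (u @ v, u' @ v') \<in> E"
    and fin: "finite (UNIV // E)"
    unfolding torsion_congruence_def by blast+
  have refl: "(u, u) \<in> E" and sym: "(u, v) \<in> E \<Longrightarrow> (v, u) \<in> E"
    and trans: "(u, v) \<in> E \<Longrightarrow> (v, t) \<in> E \<Longrightarrow> (u, t) \<in> E" for u v t
    using equiv by (auto simp: equiv_def refl_on_def dest: symD transD)
  have ev_E: "(u, v) \<in> E" if "ev u = ev v" for u v
    using that E by (simp add: ev_eq_iff)
  define N where "N = {ev u |u. (u, []) \<in> E}"
  have in_N: "ev u \<in> N \<longleftrightarrow> (u, []) \<in> E" for u
    unfolding N_def using ev_E trans by (smt (verit) mem_Collect_eq)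
  have conj: "(u @ v @ t, []) \<in> E" if "(v, []) \<in> E" "ev (u @ t) = \<one>" for u v t
    using app[OF refl[of u] app[OF that(1) refl[of t]]] ev_E[of "u @ t" "[]"] that(2) trans
    by auto
  have N_inv: "inv (ev u) \<in> N" if "(u, []) \<in> E" for u
  proof -
    obtain u' where u': "inv (ev u) = ev u'"
      using range_ev inv_closed[OF ev_closed[of u]] by (metis imageE)
    have "ev (u @ u') = ev []"
      using u' by (metis ev_Nil ev_append ev_closed r_inv)
    then have "(u @ u', []) \<in> E" by (rule ev_E)
    moreover have "(u @ u', u') \<in> E"
      using app[OF that refl[of u']] by simp
    ultimately show ?thesis
      using u' in_N sym trans by metis
  qed
  have sub: "subgroup N G"
  proof
    show "N \<subseteq> carrier G" by (auto simp: N_def)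
    show "\<one> \<in> N" using in_N[of "[]"] refl by simp
    show "inv x \<in> N" if "x \<in> N" for x
      using that N_inv by (auto simp: N_def)
    fix x y assume "x \<in> N" "y \<in> N"
    then obtain u v where "x = ev u" "y = ev v" "(u, []) \<in> E" "(v, []) \<in> E"
      by (auto simp: N_def)
    then show "x \<otimes> y \<in> N"
      using app[of u "[]" v "[]"] in_N[of "u @ v"] by simp
  qed
  have normal: "N \<lhd> G"
  proof (rule normal_invI[OF sub])
    fix x h assume x: "x \<in> carrier G" and h: "h \<in> N"
    obtain u where u: "x = ev u" using x range_ev by blast
    obtain t where t: "inv x = ev t" using x range_ev inv_closed[OF x] by (metis imageE)
    obtain v where v: "h = ev v" "(v, []) \<in> E" using h by (auto simp: N_def)
    have "ev (u @ t) = \<one>" using u t x by (metis ev_append r_inv)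
    then have "ev (u @ v @ t) \<in> N" using conj[OF v(2)] in_N by blast
    then show "x \<otimes> h \<otimes> inv x \<in> N"
      by (simp add: u t v m_assoc flip: t[unfolded u])
  qed
  have coset_eq: "N #> ev u = N #> ev v" if "(u, v) \<in> E" for u v
  proof -
    obtain t where t: "inv (ev u) = ev t"
      using range_ev inv_closed[OF ev_closed[of u]] by (metis imageE)
    have "ev (u @ t) = ev []" using t by (metis ev_Nil ev_append ev_closed r_inv)
    then have "(v @ t, []) \<in> E"
      using app[OF sym[OF that] refl[of t]] ev_E trans by blast
    then have "ev v \<otimes> inv (ev u) \<in> N" using in_N[of "v @ t"] t by simp
    moreover have "ev v = (ev v \<otimes> inv (ev u)) \<otimes> ev u"
      by (simp add: m_assoc)
    ultimately have "ev v \<in> N #> ev u"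
      unfolding r_coset_def by blast
    then show ?thesis
      using repr_independence[OF _ ev_closed sub] by blast
  qed
  have "rcosets N \<subseteq> (\<lambda>A. N #> ev (SOME u. u \<in> A)) ` (UNIV // E)"
  proof
    fix R assume "R \<in> rcosets N"
    then obtain u where u: "R = N #> ev u"
      unfolding RCOSETS_def range_ev[symmetric] by blast
    have "(u, SOME v. v \<in> E `` {u}) \<in> E"
      using someI[of "\<lambda>v. v \<in> E `` {u}" u] refl by simp
    from coset_eq[OF this] u show "R \<in> (\<lambda>A. N #> ev (SOME u. u \<in> A)) ` (UNIV // E)"
      by (intro image_eqI[of _ _ "E `` {u}"]) (simp_all add: quotientI)
  qed
  then have "finite_index_normal N G"
    using normal fin by (auto simp: finite_index_normal_def intro: finite_surj)
  moreover have "x \<notin> N" using wE in_N by (simp add: w)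
  ultimately show "\<exists>N. finite_index_normal N G \<and> x \<notin> N" by blast
qed

end

section \<open>Generators of the kernel of a finite quotient\<close>

locale finite_marked_quotient = torsion_group G ev d p k + Q: marked_group Q \<phi> d
  for G (structure) and ev d p k and Q and \<phi> +
  assumes factors: "ev u = ev v \<Longrightarrow> \<phi> u = \<phi> v"
    and finite_Q: "finite (carrier Q)"
begin

text \<open>The words whose relator imposes a genuine condition on edge labels modulo \<open>p\<close>. For any other word
the order of \<open>\<phi> w\<close> properly divides the exponent, the closed path of the relator is traversed a
multiple of \<open>p\<close> times, and its sum vanishes modulo \<open>p\<close> automatically.\<close>

definition full_order :: "nat list set" where
  "full_order = {w. group.ord Q (\<phi> w) = p ^ (to_nat w + k)}"

abbreviation orbits :: "nat list \<Rightarrow> 'c set set" where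
  "orbits w \<equiv> rcosets\<^bsub>Q\<^esub> (generate Q {\<phi> w})"

lemma quotient_relator: "\<phi> w [^]\<^bsub>Q\<^esub> (p ^ (to_nat w + k)) = \<one>\<^bsub>Q\<^esub>"
proof -
  have "\<phi> (word_pow w (p ^ (to_nat w + k))) = \<phi> []"
    by (intro factors) (simp add: ev_word_pow ev_relator)
  then show ?thesis by (simp add: Q.ev_word_pow)
qed

lemma path_sum_relator:
  assumes q: "q \<in> carrier Q"
    and orbit: "\<And>w R. w \<in> full_order \<Longrightarrow> R \<in> orbits w \<Longrightarrow>
                   int p dvd (\<Sum>r\<in>R. Q.path_sum b r w)"
  shows "int p dvd Q.path_sum b q (word_pow w (p ^ (to_nat w + k)))"
proof -
  let ?P = "p ^ (to_nat w + k)" and ?m = "Q.ord (\<phi> w)"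
  have "?m dvd ?P"
    using quotient_relator[of w] by (simp add: Q.pow_eq_id)
  then obtain t where t: "?P = t * ?m"
    by (auto simp: dvd_def mult.commute)
  have m0: "?m \<noteq> 0"
    using t p_pos by (metis mult_0_right power_not_zero not_gr0)
  have sum: "Q.path_sum b q (word_pow w ?P) =
      int t * (\<Sum>r\<in>generate Q {\<phi> w} #>\<^bsub>Q\<^esub> q. Q.path_sum b r w)"
    unfolding t by (rule Q.path_sum_power_of_order[OF q refl m0])
  show ?thesis
  proof (cases "t = 1")
    case True
    then have "w \<in> full_order"
      using t by (simp add: full_order_def)
    moreover have "generate Q {\<phi> w} #>\<^bsub>Q\<^esub> q \<in> orbits w"
      using q Q.generate_incl[of "{\<phi> w}"] by (simp add: Q.rcosetsI)
    ultimately show ?thesis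
      unfolding sum by (intro dvd_mult orbit)
  next
    case False
    \<comment> \<open>A divisor of a power of \<open>p\<close> other than \<open>1\<close> is a multiple of \<open>p\<close>.\<close>
    have "t dvd ?P" using t by simp
    then obtain i where i: "t = p ^ i"
      using prime_p divides_primepow_nat by blast
    with False have "p dvd t" by (cases i) auto
    then show ?thesis
      unfolding sum by (intro dvd_mult2) simp
  qed
qed

text \<open>If the surplus letters are labelled \<open>0\<close> and the path sums of all relators vanish modulo \<open>p\<close>, from
every starting vertex, then sending a word
to its value in \<open>Q\<close> together with its path sums modulo \<open>p\<close> from all vertices has a torsion
congruence as kernel: it is a homomorphism to a finite group, namely to a permutational wreath product of
\<open>Q\<close> with the integers modulo \<open>p\<close>. So path sums modulo \<open>p\<close> depend only on the group
element.\<close>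

lemma path_sum_mod_well_defined:
  assumes triv: "\<And>q a. q \<in> carrier Q \<Longrightarrow> d \<le> a \<Longrightarrow> b q a = 0"
    and rel: "\<And>q w. q \<in> carrier Q \<Longrightarrow>
                int p dvd Q.path_sum b q (word_pow w (p ^ (to_nat w + k)))"
    and eq: "ev u = ev v" and q: "q \<in> carrier Q"
  shows "Q.path_sum b q u mod int p = Q.path_sum b q v mod int p"
proof -
  define f where "f u = (\<phi> u, \<lambda>q\<in>carrier Q. Q.path_sum b q u mod int p)" for u
  define E where "E = {(u, v). f u = f v}"
  have E_iff: "(u, v) \<in> E \<longleftrightarrow> \<phi> u = \<phi> v \<and>
      (\<forall>q\<in>carrier Q. Q.path_sum b q u mod int p = Q.path_sum b q v mod int p)" for u v
    by (auto simp: E_def f_def restrict_def fun_eq_iff)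
  have "torsion_congruence d p k E"
    unfolding torsion_congruence_def
  proof (intro conjI allI impI)
    show "equiv UNIV E"
      by (auto simp: E_def intro!: equivI refl_onI symI transI)
    have "range f \<subseteq> carrier Q \<times> (carrier Q \<rightarrow>\<^sub>E {0..<int p})"
      using p_pos by (auto simp: f_def)
    then have "finite (range f)"
      by (rule finite_subset) (intro finite_cartesian_product finite_Q finite_PiE finite_atLeastLessThan_int)
    moreover have "UNIV // E \<subseteq> (\<lambda>y. f -` {y}) ` range f"
    proof
      fix A assume "A \<in> UNIV // E"
      then obtain u where "A = E `` {u}" by (rule quotientE)
      then have "A = f -` {f u}" by (auto simp: E_def)
      then show "A \<in> (\<lambda>y. f -` {y}) ` range f" by blast
    qed
    ultimately show "finite (UNIV // E)"
      by (meson finite_imageI finite_subset)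
    show "(u @ v, u' @ v') \<in> E" if "(u, u') \<in> E" "(v, v') \<in> E" for u u' v v'
      using that by (auto simp: E_iff Q.path_sum_append intro!: mod_add_cong)
    show "([a], []) \<in> E" if "d \<le> a" for a
      using that triv by (simp add: E_iff Q.ev_trivial)
    show "(word_pow w (p ^ (to_nat w + k)), []) \<in> E" for w
      using rel by (simp add: E_iff Q.ev_word_pow quotient_relator mod_eq_0_iff_dvd)
  qed
  then have "(u, v) \<in> E"
    using eq by (simp add: ev_eq_iff)
  then show ?thesis
    using q by (simp add: E_iff)
qed

definition quotient_kernel :: "'a set" where
  "quotient_kernel = {ev w |w. \<phi> w = \<one>\<^bsub>Q\<^esub>}"

lemma ev_in_kernel: "ev w \<in> quotient_kernel \<longleftrightarrow> \<phi> w = \<one>\<^bsub>Q\<^esub>"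
proof
  assume "ev w \<in> quotient_kernel"
  then obtain v where "ev w = ev v" "\<phi> v = \<one>\<^bsub>Q\<^esub>"
    unfolding quotient_kernel_def by blast
  with factors[of w v] show "\<phi> w = \<one>\<^bsub>Q\<^esub>" by simp
qed (auto simp: quotient_kernel_def)

text \<open>The labels are recovered from the listed data. The orbit conditions make \<open>b\<close> induce a
homomorphism from the kernel to the integers modulo \<open>p\<close>, which is zero because it is zero on
generators. All closed paths at \<open>\<one>\<close> then have sum zero, so \<open>b\<close> is the coboundary of the potential
\<open>q \<mapsto> path_sum b \<one> (word_of q)\<close>; that potential is zero too.\<close>

lemma edge_function_vanishes:
  assumes S: "generate G S = quotient_kernel"
    and triv: "\<And>q a. q \<in> carrier Q \<Longrightarrow> d \<le> a \<Longrightarrow> b q a = 0"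
    and orbit: "\<And>w R. w \<in> full_order \<Longrightarrow> R \<in> orbits w \<Longrightarrow>
                   int p dvd (\<Sum>r\<in>R. Q.path_sum b r w)"
    and gens: "\<And>s. s \<in> S \<Longrightarrow> int p dvd Q.path_sum b \<one>\<^bsub>Q\<^esub> (word_of s)"
    and reps: "\<And>q. q \<in> carrier Q \<Longrightarrow> int p dvd Q.path_sum b \<one>\<^bsub>Q\<^esub> (Q.word_of q)"
    and q: "q \<in> carrier Q"
  shows "int p dvd b q a"
proof -
  have wd: "int p dvd Q.path_sum b \<one>\<^bsub>Q\<^esub> u \<longleftrightarrow> int p dvd Q.path_sum b \<one>\<^bsub>Q\<^esub> v"
    if "ev u = ev v" for u v
    using path_sum_mod_well_defined[OF triv path_sum_relator[OF _ orbit] that Q.one_closed]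
    by (simp add: dvd_eq_mod_eq_0)
  have app: "Q.path_sum b \<one>\<^bsub>Q\<^esub> (u @ v) =
      Q.path_sum b \<one>\<^bsub>Q\<^esub> v + Q.path_sum b (\<phi> v) u" for u v
    by (simp add: Q.path_sum_append)
  have kernel: "\<forall>w. ev w = g \<longrightarrow> int p dvd Q.path_sum b \<one>\<^bsub>Q\<^esub> w" if "g \<in> generate G S" for g
    using that
  proof (induction rule: generate.induct)
    case one
    show ?case
    proof (intro allI impI)
      fix w assume "ev w = \<one>"
      then show "int p dvd Q.path_sum b \<one>\<^bsub>Q\<^esub> w" using wd[of w "[]"] by simp
    qed
  next
    case (incl s)
    then have "s \<in> quotient_kernel" using generate.incl[of s S G] S by simp
    then have ws: "ev (word_of s) = s"
      by (intro ev_word_of) (auto simp: quotient_kernel_def)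
    show ?case
    proof (intro allI impI)
      fix w assume "ev w = s"
      then show "int p dvd Q.path_sum b \<one>\<^bsub>Q\<^esub> w"
        using wd[of w "word_of s"] ws gens[OF incl] by simp
    qed
  next
    case (inv s)
    then have s: "s \<in> quotient_kernel" using generate.incl[of s S G] S by simp
    then have ws: "ev (word_of s) = s"
      by (intro ev_word_of) (auto simp: quotient_kernel_def)
    with s have \<phi>s: "\<phi> (word_of s) = \<one>\<^bsub>Q\<^esub>" using ev_in_kernel[of "word_of s"] by simp
    show ?case
    proof (intro allI impI)
      fix w assume "ev w = inv s"
      moreover have "s \<in> carrier G" using ev_closed[of "word_of s"] ws by simp
      ultimately have "ev (w @ word_of s) = ev []" by (simp add: ws)
      from wd[OF this] have "int p dvd Q.path_sum b \<one>\<^bsub>Q\<^esub> (w @ word_of s)" by simp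
      then show "int p dvd Q.path_sum b \<one>\<^bsub>Q\<^esub> w"
        using gens[OF inv] by (simp add: app \<phi>s dvd_add_right_iff)
    qed
  next
    case (eng g h)
    have "g \<in> carrier G" "h \<in> carrier G" "h \<in> quotient_kernel"
      using eng.hyps S by (auto simp: quotient_kernel_def)
    then have w: "ev (word_of g) = g" "ev (word_of h) = h" "\<phi> (word_of h) = \<one>\<^bsub>Q\<^esub>"
      using ev_word_of ev_in_kernel[of "word_of h"] by auto
    show ?case
    proof (intro allI impI)
      fix w assume "ev w = g \<otimes> h"
      then have "ev w = ev (word_of g @ word_of h)" by (simp add: w)
      moreover have "int p dvd Q.path_sum b \<one>\<^bsub>Q\<^esub> (word_of g @ word_of h)"
        using eng.IH w by (simp add: app)
      ultimately show "int p dvd Q.path_sum b \<one>\<^bsub>Q\<^esub> w" using wd by blast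
    qed
  qed
  \<comment> \<open>Closing up \<open>w\<close> and the chosen word \<open>r\<close> by the same return path \<open>v\<close> shows that their sums agree.\<close>
  have all: "int p dvd Q.path_sum b \<one>\<^bsub>Q\<^esub> w" for w
  proof -
    define r where "r = Q.word_of (\<phi> w)"
    define v where "v = Q.word_of (inv\<^bsub>Q\<^esub> \<phi> w)"
    have r: "\<phi> r = \<phi> w" and v: "\<phi> v \<otimes>\<^bsub>Q\<^esub> \<phi> w = \<one>\<^bsub>Q\<^esub>"
      by (simp_all add: r_def v_def Q.ev_word_of)
    have "ev (v @ w) \<in> quotient_kernel" "ev (v @ r) \<in> quotient_kernel"
      by (simp_all only: ev_in_kernel Q.ev_append r v)
    then have "int p dvd Q.path_sum b \<one>\<^bsub>Q\<^esub> (v @ w)" "int p dvd Q.path_sum b \<one>\<^bsub>Q\<^esub> (v @ r)"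
      using kernel S by blast+
    moreover have "int p dvd Q.path_sum b \<one>\<^bsub>Q\<^esub> r"
      unfolding r_def by (rule reps) simp
    ultimately show ?thesis
      by (simp add: app r dvd_add_right_iff dvd_add_left_iff)
  qed
  have "Q.path_sum b \<one>\<^bsub>Q\<^esub> (a # Q.word_of q) = Q.path_sum b \<one>\<^bsub>Q\<^esub> (Q.word_of q) + b q a"
    using q by (simp add: Q.ev_word_of)
  with all[of "a # Q.word_of q"] all[of "Q.word_of q"] show ?thesis
    by (simp add: dvd_add_right_iff)
qed

end
context finite_marked_quotient
begin

text \<open>Since \<open>p ^ (to_nat w + k)\<close> is then the order of an element of \<open>Q\<close>, only finitely many of the
infinitely many relators matter for a given finite quotient.\<close>

lemma full_order_less:
  assumes "w \<in> full_order"
  shows "to_nat w < order Q"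
proof -
  from assms have "p ^ (to_nat w + k) dvd order Q"
    using Q.ord_dvd_group_order[of "\<phi> w"] by (simp add: full_order_def)
  then have "p ^ (to_nat w + k) \<le> order Q"
    using finite_Q by (simp add: dvd_imp_le Q.order_gt_0_iff_finite)
  moreover have "to_nat w + k < p ^ (to_nat w + k)"
    using prime_p by (intro power_gt_expt prime_gt_Suc_0_nat)
  ultimately show ?thesis by linarith
qed

lemma finite_full_order: "finite full_order"
  by (rule finite_imageD[of to_nat])
    (auto intro: finite_subset[of _ "{..<order Q}"] full_order_less injD[OF inj_to_nat] inj_onI)

lemma card_orbits:
  assumes "w \<in> full_order"
  shows "card (orbits w) * p ^ (to_nat w + k) = order Q"
  using Q.lagrange[OF Q.generate_is_subgroup[of "{\<phi> w}"]] Q.generate_pow_card[of "\<phi> w"] assms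
  by (simp add: full_order_def)

text \<open>There are \<open>p ^ (d * order Q)\<close> labellings of the edges by residues modulo \<open>p\<close>. By the preceding
vanishing result, applied to the difference of two of them, a labelling is determined by its
path sums along the generators in \<open>S\<close>, its potential on \<open>Q\<close>, and one residue per orbit of each
relevant relator. Comparing exponents of \<open>p\<close> in this injection replaces any dimension count,
in particular the Nielsen-Schreier rank formula.\<close>

lemma generator_count:
  assumes S: "finite S" "generate G S = quotient_kernel"
  shows "d * order Q \<le> card S + order Q + (\<Sum>w\<in>full_order. card (orbits w))"
proof -
  let ?F = "{0..<int p}" and ?D = "carrier Q \<times> {..<d}"
  define T where "T = Sigma full_order orbits"
  define ext where "ext x q a = (if a < d then x (q, a) else 0)" for x :: "'c \<times> nat \<Rightarrow> int" and q a
  define \<Theta> where "\<Theta> x =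
    (\<lambda>s\<in>S. Q.path_sum (ext x) \<one>\<^bsub>Q\<^esub> (word_of s) mod int p,
     \<lambda>q\<in>carrier Q. Q.path_sum (ext x) \<one>\<^bsub>Q\<^esub> (Q.word_of q) mod int p,
     \<lambda>(w, R)\<in>T. (\<Sum>r\<in>R. Q.path_sum (ext x) r w) mod int p)" for x
  have finite_orbits: "finite (orbits w)" for w
    using finite_Q Q.generate_incl[of "{\<phi> w}"] Q.rcosets_subset_PowG[OF Q.generate_is_subgroup]
    by (meson Q.ev_closed empty_subsetI finite_Pow_iff finite_subset insert_subset)
  have finite_T: "finite T"
    unfolding T_def using finite_full_order finite_orbits by auto
  have card_T: "card T = (\<Sum>w\<in>full_order. card (orbits w))"
    unfolding T_def using finite_full_order finite_orbits by simp
  have "inj_on \<Theta> (?D \<rightarrow>\<^sub>E ?F)"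
  proof (rule inj_onI)
    fix x y assume x: "x \<in> ?D \<rightarrow>\<^sub>E ?F" and y: "y \<in> ?D \<rightarrow>\<^sub>E ?F" and eq: "\<Theta> x = \<Theta> y"
    define b where "b q a = ext x q a - ext y q a" for q a
    have sum_b: "Q.path_sum b q w = Q.path_sum (ext x) q w - Q.path_sum (ext y) q w" for q w
      unfolding b_def by (rule Q.path_sum_diff)
    have b_dvd: "int p dvd b q a" if "q \<in> carrier Q" for q a
      using S(2)
    proof (rule edge_function_vanishes)
      show "b q a = 0" if "d \<le> a" for q a
        using that by (simp add: b_def ext_def)
      show "int p dvd (\<Sum>r\<in>R. Q.path_sum b r w)" if "w \<in> full_order" "R \<in> orbits w" for w R
      proof -
        have "(w, R) \<in> T" using that by (simp add: T_def)
        then have "(\<Sum>r\<in>R. Q.path_sum (ext x) r w) mod int p = (\<Sum>r\<in>R. Q.path_sum (ext y) r w) mod int p"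
          using eq by (auto simp: \<Theta>_def restrict_def dest!: fun_cong[of _ _ "(w, R)"])
        then show ?thesis
          by (simp add: sum_b sum_subtractf mod_eq_dvd_iff)
      qed
      show "int p dvd Q.path_sum b \<one>\<^bsub>Q\<^esub> (word_of s)" if "s \<in> S" for s
        using eq that by (auto simp: \<Theta>_def restrict_def sum_b simp flip: mod_eq_dvd_iff dest!: fun_cong[of _ _ s])
      show "int p dvd Q.path_sum b \<one>\<^bsub>Q\<^esub> (Q.word_of q)" if "q \<in> carrier Q" for q
        using eq that by (auto simp: \<Theta>_def restrict_def sum_b simp flip: mod_eq_dvd_iff dest!: fun_cong[of _ _ q])
      show "q \<in> carrier Q" by fact
    qed
    have xy: "x (q, a) mod int p = y (q, a) mod int p" if "q \<in> carrier Q" "a < d" for q a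
      using b_dvd[OF that(1), of a] that(2) by (simp add: b_def ext_def mod_eq_dvd_iff)
    show "x = y"
    proof (rule PiE_ext[OF x y])
      fix z assume z: "z \<in> ?D"
      then have "x z \<in> ?F" "y z \<in> ?F" using x y by (auto simp: PiE_def Pi_def)
      moreover have "x z mod int p = y z mod int p" using z xy by (cases z) auto
      ultimately show "x z = y z" by simp
    qed
  qed
  moreover have "\<Theta> ` (?D \<rightarrow>\<^sub>E ?F) \<subseteq> (S \<rightarrow>\<^sub>E ?F) \<times> (carrier Q \<rightarrow>\<^sub>E ?F) \<times> (T \<rightarrow>\<^sub>E ?F)"
  proof (rule image_subsetI)
    show "\<Theta> x \<in> (S \<rightarrow>\<^sub>E ?F) \<times> (carrier Q \<rightarrow>\<^sub>E ?F) \<times> (T \<rightarrow>\<^sub>E ?F)" for x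
      unfolding \<Theta>_def mem_Times_iff fst_conv snd_conv restrict_PiE_iff
      using p_pos by (simp add: case_prod_beta)
  qed
  moreover have "finite ((S \<rightarrow>\<^sub>E ?F) \<times> (carrier Q \<rightarrow>\<^sub>E ?F) \<times> (T \<rightarrow>\<^sub>E ?F))"
    by (intro finite_cartesian_product finite_PiE S(1) finite_Q finite_T finite_atLeastLessThan_int)
  ultimately have "card (?D \<rightarrow>\<^sub>E ?F) \<le> card ((S \<rightarrow>\<^sub>E ?F) \<times> (carrier Q \<rightarrow>\<^sub>E ?F) \<times> (T \<rightarrow>\<^sub>E ?F))"
    by (rule card_inj_on_le)
  then have "p ^ (order Q * d) \<le> p ^ (card S + order Q + card T)"
    using finite_Q S(1) finite_T
    by (simp add: card_PiE card_cartesian_product power_add order_def mult.assoc)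
  then have "order Q * d \<le> card S + order Q + card T"
    using prime_p by (simp add: prime_gt_Suc_0_nat power_increasing_iff[of p] prime_gt_1_nat)
  then show ?thesis
    by (simp add: card_T mult.commute)
qed

section \<open>The rank gradient and infinitude\<close>

text \<open>A word of full order has \<open>order Q / p ^ (to_nat w + k)\<close> orbits; as the code numbers are distinct,
a geometric series with ratio \<open>1/2\<close> dominates the sum.\<close>

lemma sum_orbits_le:
  "(\<Sum>w\<in>full_order. real (card (orbits w))) \<le> real (order Q) * (2 / 2 ^ k)"
proof -
  have "real (card (orbits w)) \<le> real (order Q) / 2 ^ k * (1/2) ^ to_nat w"
    if w: "w \<in> full_order" for w
  proof -
    have "(2::real) ^ (to_nat w + k) \<le> real p ^ (to_nat w + k)"
      using prime_ge_2_nat[OF prime_p] by (intro power_mono) auto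
    then have "real (card (orbits w)) * 2 ^ (to_nat w + k) \<le>
        real (card (orbits w)) * real p ^ (to_nat w + k)"
      by (rule mult_left_mono) simp
    also have "\<dots> = real (order Q)"
      using card_orbits[OF w] by (metis of_nat_mult of_nat_power)
    finally show ?thesis
      by (simp add: power_add field_simps)
  qed
  then have "(\<Sum>w\<in>full_order. real (card (orbits w))) \<le>
      (\<Sum>w\<in>full_order. real (order Q) / 2 ^ k * (1/2) ^ to_nat w)"
    by (rule sum_mono)
  also have "\<dots> = real (order Q) / 2 ^ k * (\<Sum>i\<in>to_nat ` full_order. (1/2) ^ i)"
    by (simp add: sum_distrib_left sum.reindex[OF inj_on_subset[OF inj_to_nat subset_UNIV]])
  also have "\<dots> \<le> real (order Q) / 2 ^ k * suminf (\<lambda>i. (1/2) ^ i)"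
    using finite_full_order by (intro mult_left_mono sum_le_suminf summable_geometric) auto
  also have "suminf (\<lambda>i. (1/2::real) ^ i) = 2"
    by (subst suminf_geometric) auto
  finally show ?thesis by simp
qed

lemma generator_bound:
  assumes "finite S" "generate G S = quotient_kernel"
  shows "real (order Q) * (real d - 1 - 2 / 2 ^ k) \<le> real (card S)"
proof -
  have "real (d * order Q) \<le> real (card S + order Q + (\<Sum>w\<in>full_order. card (orbits w)))"
    using generator_count[OF assms] by (rule of_nat_mono)
  then show ?thesis
    using sum_orbits_le by (simp add: algebra_simps)
qed

end

context torsion_group
begin

lemma normal_subgroup_generators:
  assumes N: "finite_index_normal N G" and S: "finite S" "generate G S = N"
  shows "real (card (rcosets N)) * (real d - 1 - 2 / 2 ^ k) \<le> real (card S)"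
proof -
  interpret N: normal N G using N by (simp add: finite_index_normal_def)
  interpret Q: marked_group "G Mod N" "\<lambda>w. N #> ev w" d
    by (rule marked_quotient) (rule N.normal_axioms)
  interpret quotient: finite_marked_quotient G ev d p k "G Mod N" "\<lambda>w. N #> ev w"
  proof
    show "finite (carrier (G Mod N))"
      using N by (simp add: finite_index_normal_def FactGroup_def)
  qed simp
  have "quotient.quotient_kernel = N"
  proof -
    have "N #> ev w = N \<longleftrightarrow> ev w \<in> N" for w
      using N.rcos_const rcos_self[OF ev_closed N.is_subgroup, of w] by auto
    moreover have "N \<subseteq> range ev" using range_ev N.subset by simp
    ultimately show ?thesis
      by (auto simp: quotient.quotient_kernel_def)
  qed
  then show ?thesis
    using quotient.generator_bound[OF S(1)] S(2) by (simp add: order_def FactGroup_def)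
qed

lemma rank_gradient_ge: "ereal (real d - 1 - 2 / 2 ^ k) \<le> rank_gradient G"
  unfolding rank_gradient_def
proof (rule Inf_greatest, clarify)
  fix N :: "nat \<Rightarrow> 'a set"
  assume fin: "\<forall>i. finite_index_normal (N i) G"
  have "ereal (real d - 1 - 2 / 2 ^ k) \<le>
      ereal (real (min_generators (G\<lparr>carrier := N i\<rparr>)) / real (card (rcosets (N i))))" for i
  proof -
    have Ni: "finite_index_normal (N i) G" and sub: "subgroup (N i) G"
      using fin by (auto simp: finite_index_normal_def normal_imp_subgroup)
    have "generated_by_card (G\<lparr>carrier := N i\<rparr>) (min_generators (G\<lparr>carrier := N i\<rparr>))"
      unfolding min_generators_def
      using finite_index_normal_finitely_generated[OF Ni] by (rule LeastI_ex)
    then obtain S where S: "finite S" "generate G S = N i"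
        and card_S: "card S \<le> min_generators (G\<lparr>carrier := N i\<rparr>)"
      using generate_consistent[OF _ sub] by (auto simp: generated_by_card_def)
    have "N i \<in> rcosets (N i)"
      by (rule subgroup.subgroup_in_rcosets[OF sub is_group])
    then have "card (rcosets (N i)) > 0"
      using Ni by (auto simp: finite_index_normal_def card_gt_0_iff)
    moreover have "real (card (rcosets (N i))) * (real d - 1 - 2 / 2 ^ k) \<le>
        real (min_generators (G\<lparr>carrier := N i\<rparr>))"
      using normal_subgroup_generators[OF Ni S] card_S by linarith
    ultimately show ?thesis
      by (simp add: pos_le_divide_eq mult.commute)
  qed
  then show "ereal (real d - 1 - 2 / 2 ^ k) \<le> rank_gradient_along G N"
    unfolding rank_gradient_along_def by (intro Liminf_bounded always_eventually) blast
qed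

text \<open>In a finite group the generator bound applies to the trivial subgroup, which needs no
generators.\<close>

lemma infinite_carrier:
  assumes "2 / 2 ^ k < real d - 1"
  shows "infinite (carrier G)"
proof
  assume fin: "finite (carrier G)"
  have "finite (rcosets {\<one>})"
    using fin by (simp add: RCOSETS_def)
  then have "finite_index_normal {\<one>} G"
    by (simp add: finite_index_normal_def one_is_normal)
  from normal_subgroup_generators[OF this, of "{}"]
  have "real (card (rcosets {\<one>})) * (real d - 1 - 2 / 2 ^ k) \<le> 0"
    by (simp add: generate_empty)
  moreover have "card (rcosets {\<one>}) > 0"
    using \<open>finite (rcosets {\<one>})\<close> by (auto simp: RCOSETS_def card_gt_0_iff)
  ultimately show False
    using assms by (simp add: mult_le_0_iff)
qed

end
section \<open>Existence of the universal quotient\<close>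

definition torsion_relation :: "nat \<Rightarrow> nat \<Rightarrow> nat \<Rightarrow> (nat list \<times> nat list) set" where
  "torsion_relation d p k = \<Inter> {E. torsion_congruence d p k E}"

text \<open>A canonical representative of the class of a word, as a natural number: the least code of a word
in the class. It makes the quotient a group on \<open>nat\<close> instead of on classes of words.\<close>

definition word_code :: "nat \<Rightarrow> nat \<Rightarrow> nat \<Rightarrow> nat list \<Rightarrow> nat" where
  "word_code d p k w = (LEAST m. (w, from_nat m) \<in> torsion_relation d p k)"

definition torsion_quotient :: "nat \<Rightarrow> nat \<Rightarrow> nat \<Rightarrow> nat monoid" where
  "torsion_quotient d p k =
     \<lparr>carrier = range (word_code d p k),
      monoid.mult = (\<lambda>x y. word_code d p k (from_nat x @ from_nat y)),
      one = word_code d p k []\<rparr>"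

lemma torsion_relation_iff:
  "(u, v) \<in> torsion_relation d p k \<longleftrightarrow> (\<forall>E. torsion_congruence d p k E \<longrightarrow> (u, v) \<in> E)"
  by (auto simp: torsion_relation_def)

lemma equiv_torsion_relation: "equiv UNIV (torsion_relation d p k)"
proof (rule equivI)
  have eq: "equiv UNIV E" if "torsion_congruence d p k E" for E
    using that by (simp add: torsion_congruence_def)
  show "torsion_relation d p k \<subseteq> UNIV \<times> UNIV" by simp
  show "refl_on UNIV (torsion_relation d p k)"
    using eq by (auto intro!: refl_onI simp: torsion_relation_iff equiv_def refl_on_def)
  show "sym (torsion_relation d p k)"
    using eq by (intro symI) (metis torsion_relation_iff equiv_def symD)
  show "trans (torsion_relation d p k)"
    using eq by (intro transI) (metis torsion_relation_iff equiv_def transD)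
qed

lemma torsion_relation_append:
  assumes "(u, u') \<in> torsion_relation d p k" "(v, v') \<in> torsion_relation d p k"
  shows "(u @ v, u' @ v') \<in> torsion_relation d p k"
  using assms unfolding torsion_relation_iff torsion_congruence_def by blast

lemma word_code_rel: "(w, from_nat (word_code d p k w)) \<in> torsion_relation d p k"
proof -
  have "(w, from_nat (to_nat w)) \<in> torsion_relation d p k"
    using equiv_torsion_relation[of d p k] by (simp add: equiv_def refl_on_def)
  then show ?thesis
    unfolding word_code_def by (rule LeastI)
qed

lemma word_code_eq_iff:
  "word_code d p k u = word_code d p k v \<longleftrightarrow> (u, v) \<in> torsion_relation d p k"
proof
  note eq = equiv_torsion_relation[of d p k]
  assume "word_code d p k u = word_code d p k v"
  then show "(u, v) \<in> torsion_relation d p k"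
    using word_code_rel[of u d p k] word_code_rel[of v d p k] eq
    by (metis equiv_def symD transD)
next
  assume "(u, v) \<in> torsion_relation d p k"
  then have "(u, t) \<in> torsion_relation d p k \<longleftrightarrow> (v, t) \<in> torsion_relation d p k" for t
    using equiv_torsion_relation[of d p k] by (metis equiv_def symD transD)
  then show "word_code d p k u = word_code d p k v"
    by (simp add: word_code_def)
qed

lemma word_code_mult:
  "word_code d p k u \<otimes>\<^bsub>torsion_quotient d p k\<^esub> word_code d p k v = word_code d p k (u @ v)"
proof -
  have "(u @ v, from_nat (word_code d p k u) @ from_nat (word_code d p k v)) \<in> torsion_relation d p k"
    by (intro torsion_relation_append word_code_rel)
  then show ?thesis
    by (simp add: torsion_quotient_def flip: word_code_eq_iff)
qed

text \<open>The monoid is a group because each word \<open>w\<close> has a relator \<open>w ^ n\<close> with \<open>n > 0\<close>, which makes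
\<open>w ^ (n - 1)\<close> its inverse.\<close>

lemma torsion_quotient_group:
  assumes "0 < p"
  shows "group (torsion_quotient d p k)"
proof (rule groupI)
  let ?G = "torsion_quotient d p k" and ?c = "word_code d p k"
  have carrier: "carrier ?G = range ?c" and one: "\<one>\<^bsub>?G\<^esub> = ?c []"
    by (simp_all add: torsion_quotient_def)
  show "\<one>\<^bsub>?G\<^esub> \<in> carrier ?G"
    by (simp add: carrier one)
  show "x \<otimes>\<^bsub>?G\<^esub> y \<in> carrier ?G" if "x \<in> carrier ?G" "y \<in> carrier ?G" for x y
    using that by (auto simp: carrier word_code_mult)
  show "x \<otimes>\<^bsub>?G\<^esub> y \<otimes>\<^bsub>?G\<^esub> z = x \<otimes>\<^bsub>?G\<^esub> (y \<otimes>\<^bsub>?G\<^esub> z)"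
    if "x \<in> carrier ?G" "y \<in> carrier ?G" "z \<in> carrier ?G" for x y z
    using that by (auto simp: carrier word_code_mult)
  show "\<one>\<^bsub>?G\<^esub> \<otimes>\<^bsub>?G\<^esub> x = x" if "x \<in> carrier ?G" for x
    using that by (auto simp: carrier one word_code_mult)
  show "\<exists>y\<in>carrier ?G. y \<otimes>\<^bsub>?G\<^esub> x = \<one>\<^bsub>?G\<^esub>" if "x \<in> carrier ?G" for x
  proof -
    from that obtain w where w: "x = ?c w" by (auto simp: carrier)
    define n where "n = p ^ (to_nat w + k)"
    have "n = n - 1 + 1" using assms by (simp add: n_def)
    then have "word_pow w n = word_pow w (n - 1) @ word_pow w 1"
      by (metis word_pow_add)
    then have "?c (word_pow w (n - 1)) \<otimes>\<^bsub>?G\<^esub> x = ?c (word_pow w n)"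
      by (simp add: w word_code_mult word_pow_Suc[of w 0, simplified])
    also have "\<dots> = \<one>\<^bsub>?G\<^esub>"
      by (simp add: one word_code_eq_iff torsion_relation_iff torsion_congruence_def n_def)
    finally show ?thesis
      by (auto simp: carrier)
  qed
qed

lemma torsion_group_torsion_quotient:
  assumes "Factorial_Ring.prime p"
  shows "torsion_group (torsion_quotient d p k) (word_code d p k) d p k"
proof -
  interpret group "torsion_quotient d p k"
    using assms by (intro torsion_quotient_group prime_gt_0_nat)
  show ?thesis
  proof
    show "word_code d p k [a] = \<one>\<^bsub>torsion_quotient d p k\<^esub>" if "d \<le> a" for a
    proof -
      have "([a], []) \<in> torsion_relation d p k"
        using that by (simp add: torsion_relation_iff torsion_congruence_def)
      then show ?thesis
        by (simp add: torsion_quotient_def word_code_eq_iff)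
    qed
    show "word_code d p k (u @ v) =
        word_code d p k u \<otimes>\<^bsub>torsion_quotient d p k\<^esub> word_code d p k v" for u v
      by (rule word_code_mult[symmetric])
    show "word_code d p k u = word_code d p k v \<longleftrightarrow>
        (\<forall>E. torsion_congruence d p k E \<longrightarrow> (u, v) \<in> E)" for u v
      by (simp add: word_code_eq_iff torsion_relation_iff)
  qed (simp_all add: torsion_quotient_def assms)
qed

section \<open>Torsion groups of large rank gradient\<close>

theorem theorem1:
  fixes d p :: nat and \<epsilon> :: real
  assumes "d \<ge> 2" and "Factorial_Ring.prime p" and "\<epsilon> > 0"
  shows "\<exists>\<Gamma> :: nat monoid.
           group \<Gamma> \<and> generated_by_card \<Gamma> d \<and> infinite (carrier \<Gamma>) \<and>
           residually_finite \<Gamma> \<and> p_group p \<Gamma> \<and>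
           rank_gradient \<Gamma> \<ge> ereal (real d - 1 - \<epsilon>)"
proof -
  \<comment> \<open>The bound \<open>\<epsilon> / 2\<close> controls the rank gradient; the bound \<open>1/2\<close> forces infinitude even for large \<open>\<epsilon>\<close>.\<close>
  obtain k where k: "(1/2::real) ^ k < min (\<epsilon> / 2) (1/2)"
    using real_arch_pow_inv[of "min (\<epsilon> / 2) (1/2)" "1/2"] assms(3) by auto
  then have small: "2 / 2 ^ k < \<epsilon>" "2 / 2 ^ k < (1::real)"
    by (simp_all add: power_one_over field_simps)
  interpret torsion_group "torsion_quotient d p k" "word_code d p k" d p k
    using assms(2) by (rule torsion_group_torsion_quotient)
  have "infinite (carrier (torsion_quotient d p k))"
    using small assms(1) by (intro infinite_carrier) linarith
  moreover have "ereal (real d - 1 - \<epsilon>) \<le> rank_gradient (torsion_quotient d p k)"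
    using small by (intro order_trans[OF _ rank_gradient_ge]) simp
  ultimately show ?thesis
    using is_group generated_by_d residually_finite p_group by blast
qed

end
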